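(* Let $V$ be the call price, $C^{\mathrm{ref}}$ the strike-matched carrier, $\chi=\tau/T$ with $\tau=T-t$, and for $\tau>0$ let $R^*=(V-C^{\mathrm{ref}})/\chi$. Let $R_\theta(S,t)$ be a function, and set $z_\theta=C^{\mathrm{ref}}+\chi R_\theta$ and $\rho_\theta=R_\theta-R^*$. Let $\Omega$ be a set of points $(S,t)$ with $S>0$ and $\tau\in(0,T]$ on which all the derivatives below exist classically. Then $z_\theta-V=\chi\rho_\theta$ on $\Omega$, and, if $$N_\rho=\sup_\Omega\Bigl(\frac{|\rho_\theta|}{K}+\sqrt\chi\,|\partial_S\rho_\theta|+\chi K|\partial_{SS}\rho_\theta|\Bigr)$$ is finite, then on $\Omega$ $$\frac{|z_\theta-V|}{K}\le\chi N_\rho,\qquad |\partial_Sz_\theta-\partial_SV|\le\sqrt\chi\,N_\rho,\qquad K|\partial_{SS}z_\theta-\partial_{SS}V|\le N_\rho .$$ Moreover, on $\Omega$, $$\mathcal P_a z_\theta=-f+\chi\,\mathcal P_aR_\theta+\frac{R_\theta}{T}=\chi\,\mathcal P_a\rho_\theta+\frac{\rho_\theta}{T}.$$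
   Context: Setting: European call on a non-dividend-paying asset with strike $K>0$, maturity $T>0$, constant rate $r$, and local variance $a(S,t)>0$; $\tau=T-t$ is the remaining time. Functions of $(S,t)$ are regarded as functions of $(S,\tau)$ via $t=T-\tau$, and $$\mathcal P_a=\partial_\tau-\tfrac12a(S,T-\tau)S^2\partial_{SS}-rS\partial_S+r .$$ The price $V$ satisfies $\mathcal P_aV=0$ for $\tau>0$ and $V=(S-K)^+$ at $\tau=0$. Carrier: with $A_0(\tau)=\int_0^\tau a(K,T-u)\,du>0$ and $\Phi$ the standard normal distribution function, for $S>0$, $\tau>0$, $$C^{\mathrm{ref}}=S\Phi(d_+)-Ke^{-r\tau}\Phi(d_-),\qquad d_\pm=\frac{\log(S/K)+r\tau\pm A_0(\tau)/2}{\sqrt{A_0(\tau)}} .$$ The source is $f(S,\tau)=\tfrac12[a(S,T-\tau)-a(K,T-\tau)]\,S^2\,\partial_{SS}C^{\mathrm{ref}}$. It is assumed that $A_0'(\tau)=a(K,T-\tau)$ at the points considered. *)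

theory Defs
  imports "HOL-Probability.Probability"
begin

text \<open>Contract data and unknowns (\<open>a\<close>, \<open>V\<close>, \<open>R\<^sub>\<theta>\<close>) are functions of \<open>(S, t)\<close>;
  the differential operators act on functions of \<open>(S, \<tau>)\<close>.\<close>

definition in_tau :: "real \<Rightarrow> (real \<Rightarrow> real \<Rightarrow> real) \<Rightarrow> real \<Rightarrow> real \<Rightarrow> real" where
  "in_tau T u S \<tau> = u S (T - \<tau>)"

definition D_S :: "(real \<Rightarrow> real \<Rightarrow> real) \<Rightarrow> real \<Rightarrow> real \<Rightarrow> real" where
  "D_S u S \<tau> = deriv (\<lambda>s. u s \<tau>) S"

definition D_SS :: "(real \<Rightarrow> real \<Rightarrow> real) \<Rightarrow> real \<Rightarrow> real \<Rightarrow> real" where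
  "D_SS u S \<tau> = deriv (\<lambda>s. D_S u s \<tau>) S"

text \<open>Prices are given for \<open>0 \<le> \<tau> \<le> T\<close> only, so at \<open>\<tau> = T\<close> the time derivative is one-sided;
  for \<open>0 < \<tau> < T\<close> it is the ordinary two-sided one.\<close>

definition D_tau :: "real \<Rightarrow> (real \<Rightarrow> real \<Rightarrow> real) \<Rightarrow> real \<Rightarrow> real \<Rightarrow> real" where
  "D_tau T u S \<tau> = vector_derivative (\<lambda>\<sigma>. u S \<sigma>) (at \<tau> within {0..T})"

definition classical_at :: "real \<Rightarrow> (real \<Rightarrow> real \<Rightarrow> real) \<Rightarrow> real \<Rightarrow> real \<Rightarrow> bool" where
  "classical_at T u S \<tau> \<longleftrightarrow>
     (\<forall>\<^sub>F s in nhds S. (\<lambda>s'. u s' \<tau>) differentiable (at s)) \<and>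
     (\<lambda>s. D_S u s \<tau>) differentiable (at S) \<and>
     (\<lambda>\<sigma>. u S \<sigma>) differentiable (at \<tau> within {0..T})"

definition P_op ::
  "(real \<Rightarrow> real \<Rightarrow> real) \<Rightarrow> real \<Rightarrow> real \<Rightarrow> (real \<Rightarrow> real \<Rightarrow> real) \<Rightarrow> real \<Rightarrow> real \<Rightarrow> real" where
  "P_op a r T u S \<tau> =
     D_tau T u S \<tau> - 1 / 2 * a S (T - \<tau>) * S\<^sup>2 * D_SS u S \<tau> - r * S * D_S u S \<tau> + r * u S \<tau>"

text \<open>The equation is imposed wherever its derivatives exist, so a price that is
  classical only on part of the domain is allowed.\<close>

definition call_price ::
  "(real \<Rightarrow> real \<Rightarrow> real) \<Rightarrow> real \<Rightarrow> real \<Rightarrow> real \<Rightarrow> (real \<Rightarrow> real \<Rightarrow> real) \<Rightarrow> bool" where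
  "call_price a r K T V \<longleftrightarrow>
     (\<forall>S>0. \<forall>\<tau>\<in>{0<..T}. classical_at T (in_tau T V) S \<tau> \<longrightarrow> P_op a r T (in_tau T V) S \<tau> = 0) \<and>
     (\<forall>S>0. in_tau T V S 0 = max (S - K) 0)"

definition A0 :: "(real \<Rightarrow> real \<Rightarrow> real) \<Rightarrow> real \<Rightarrow> real \<Rightarrow> real \<Rightarrow> real" where
  "A0 a K T \<tau> = integral {0..\<tau>} (\<lambda>u. a K (T - u))"

definition std_normal_cdf :: "real \<Rightarrow> real" where
  "std_normal_cdf = cdf std_normal_distribution"

definition d_plus ::
  "(real \<Rightarrow> real \<Rightarrow> real) \<Rightarrow> real \<Rightarrow> real \<Rightarrow> real \<Rightarrow> real \<Rightarrow> real \<Rightarrow> real" where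
  "d_plus a r K T S \<tau> = (ln (S / K) + r * \<tau> + A0 a K T \<tau> / 2) / sqrt (A0 a K T \<tau>)"

definition d_minus ::
  "(real \<Rightarrow> real \<Rightarrow> real) \<Rightarrow> real \<Rightarrow> real \<Rightarrow> real \<Rightarrow> real \<Rightarrow> real \<Rightarrow> real" where
  "d_minus a r K T S \<tau> = (ln (S / K) + r * \<tau> - A0 a K T \<tau> / 2) / sqrt (A0 a K T \<tau>)"

definition C_ref ::
  "(real \<Rightarrow> real \<Rightarrow> real) \<Rightarrow> real \<Rightarrow> real \<Rightarrow> real \<Rightarrow> real \<Rightarrow> real \<Rightarrow> real" where
  "C_ref a r K T S \<tau> =
     S * std_normal_cdf (d_plus a r K T S \<tau>)
     - K * exp (- r * \<tau>) * std_normal_cdf (d_minus a r K T S \<tau>)"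

definition source ::
  "(real \<Rightarrow> real \<Rightarrow> real) \<Rightarrow> real \<Rightarrow> real \<Rightarrow> real \<Rightarrow> real \<Rightarrow> real \<Rightarrow> real" where
  "source a r K T S \<tau> =
     1 / 2 * (a S (T - \<tau>) - a K (T - \<tau>)) * S\<^sup>2 * D_SS (C_ref a r K T) S \<tau>"

definition R_star ::
  "(real \<Rightarrow> real \<Rightarrow> real) \<Rightarrow> real \<Rightarrow> real \<Rightarrow> real \<Rightarrow> (real \<Rightarrow> real \<Rightarrow> real) \<Rightarrow> real \<Rightarrow> real \<Rightarrow> real" where
  "R_star a r K T V S \<tau> = (in_tau T V S \<tau> - C_ref a r K T S \<tau>) / (\<tau> / T)"

definition z_theta ::
  "(real \<Rightarrow> real \<Rightarrow> real) \<Rightarrow> real \<Rightarrow> real \<Rightarrow> real \<Rightarrow> (real \<Rightarrow> real \<Rightarrow> real) \<Rightarrow> real \<Rightarrow> real \<Rightarrow> real" where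
  "z_theta a r K T R S \<tau> = C_ref a r K T S \<tau> + \<tau> / T * in_tau T R S \<tau>"

definition rho_theta ::
  "(real \<Rightarrow> real \<Rightarrow> real) \<Rightarrow> real \<Rightarrow> real \<Rightarrow> real \<Rightarrow> (real \<Rightarrow> real \<Rightarrow> real) \<Rightarrow> (real \<Rightarrow> real \<Rightarrow> real)
    \<Rightarrow> real \<Rightarrow> real \<Rightarrow> real" where
  "rho_theta a r K T V R S \<tau> = in_tau T R S \<tau> - R_star a r K T V S \<tau>"

text \<open>The scaled \<open>C\<^sup>2\<close> size of a function of \<open>(S, \<tau>)\<close> at a point \<open>(S, t)\<close>,
  and its supremum over a set of points \<open>(S, t)\<close>.\<close>

definition scaled_size :: "real \<Rightarrow> real \<Rightarrow> (real \<Rightarrow> real \<Rightarrow> real) \<Rightarrow> real \<times> real \<Rightarrow> real" where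
  "scaled_size K T u = (\<lambda>(S, t). let \<tau> = T - t in
     \<bar>u S \<tau>\<bar> / K + sqrt (\<tau> / T) * \<bar>D_S u S \<tau>\<bar> + \<tau> / T * K * \<bar>D_SS u S \<tau>\<bar>)"

definition scaled_norm :: "real \<Rightarrow> real \<Rightarrow> (real \<times> real) set \<Rightarrow> (real \<Rightarrow> real \<Rightarrow> real) \<Rightarrow> real" where
  "scaled_norm K T \<Omega> u = (SUP p\<in>\<Omega>. scaled_size K T u p)"

end

theory Submission
  imports Defs
begin

text \<open>Everything is linear once the carrier is known to be classical with
  \<open>P_op C_ref = - source\<close>. The latter is the Black--Scholes computation with \<open>A0\<close> as total variance:
  \<open>S \<phi>(d\<^sub>+) = K exp (-r\<tau>) \<phi>(d\<^sub>-)\<close> collapses the derivatives of \<open>C_ref\<close> to its explicit Greeks.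
  The operator acts on \<open>\<chi> u\<close> as \<open>\<chi> P_op u + u / T\<close>, and \<open>z - v = \<chi> \<rho>\<close> transfers
  to the spatial derivatives because \<open>\<chi>\<close> does not depend on \<open>S\<close>.\<close>

section \<open>Derivative data at a point: two orders in \<open>S\<close>, one in \<tau>\<close>

text \<open>Relational counterpart of \<open>classical_at\<close> with the derivative values as
  arguments, so that sums and products can be computed entry by entry. The witness \<open>g\<close>
  is the first derivative on a neighbourhood of \<open>S\<close>, as a second derivative at
  \<open>S\<close> requires; the time derivative is taken within \<open>{0..T}\<close>, hence
  one-sided at \<tau> = \<open>T\<close>, as in \<open>D_tau\<close>.\<close>

definition has_jet ::
  "real \<Rightarrow> (real \<Rightarrow> real \<Rightarrow> real) \<Rightarrow> real \<Rightarrow> real \<Rightarrow> real \<Rightarrow> real \<Rightarrow> real \<Rightarrow> bool" where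
  "has_jet T u S \<tau> u\<^sub>S u\<^sub>S\<^sub>S u\<^sub>\<tau> \<longleftrightarrow>
     (\<exists>g. (\<forall>\<^sub>F s in nhds S. ((\<lambda>s'. u s' \<tau>) has_real_derivative g s) (at s)) \<and>
          g S = u\<^sub>S \<and> (g has_real_derivative u\<^sub>S\<^sub>S) (at S)) \<and>
     (u S has_real_derivative u\<^sub>\<tau>) (at \<tau> within {0..T})"

text \<open>Derivatives within a nondegenerate closed interval are unique, also at its endpoints;
  \<open>T > 0\<close> excludes the one-point interval, where every number is a derivative.\<close>

lemma D_tau_eq:
  assumes "(u S has_real_derivative d) (at \<tau> within {0..T})" "\<tau> \<in> {0..T}" "T > 0"
  shows "D_tau T u S \<tau> = d"
  unfolding D_tau_def
  using assms vector_derivative_within_closed_interval[of 0 T \<tau> "u S" d]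
  by (simp add: has_real_derivative_iff_has_vector_derivative)

lemma has_jet_D:
  assumes "has_jet T u S \<tau> p q w" "\<tau> \<in> {0..T}" "T > 0"
  shows "D_S u S \<tau> = p" "D_SS u S \<tau> = q" "D_tau T u S \<tau> = w"
proof -
  obtain g where g: "\<forall>\<^sub>F s in nhds S. ((\<lambda>s'. u s' \<tau>) has_real_derivative g s) (at s)"
      "g S = p" "(g has_real_derivative q) (at S)"
    and t: "(u S has_real_derivative w) (at \<tau> within {0..T})"
    using assms(1) unfolding has_jet_def by blast
  \<comment> \<open>Agreement near \<open>S\<close>, not only at \<open>S\<close>, makes
    \<open>D_S u\<close> inherit the derivative of \<open>g\<close>.\<close>
  have ev: "\<forall>\<^sub>F s in nhds S. D_S u s \<tau> = g s"
    using g(1) by eventually_elim (simp add: D_S_def DERIV_imp_deriv)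
  show "D_S u S \<tau> = p"
    using eventually_nhds_x_imp_x[OF ev] g(2) by simp
  have "((\<lambda>s. D_S u s \<tau>) has_real_derivative q) (at S)"
    using DERIV_cong_ev[OF refl ev refl] g(3) by simp
  then show "D_SS u S \<tau> = q"
    unfolding D_SS_def by (rule DERIV_imp_deriv)
  show "D_tau T u S \<tau> = w"
    using D_tau_eq t assms(2,3) by blast
qed

lemma classical_at_has_jet:
  assumes "classical_at T u S \<tau>" "\<tau> \<in> {0..T}" "T > 0"
  shows "has_jet T u S \<tau> (D_S u S \<tau>) (D_SS u S \<tau>) (D_tau T u S \<tau>)"
proof -
  have "\<forall>\<^sub>F s in nhds S. ((\<lambda>s'. u s' \<tau>) has_real_derivative D_S u s \<tau>) (at s)"
    using assms(1) unfolding classical_at_def D_S_def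
    by (auto elim!: eventually_mono simp: DERIV_deriv_iff_real_differentiable)
  moreover have "((\<lambda>s. D_S u s \<tau>) has_real_derivative D_SS u S \<tau>) (at S)"
    using assms(1) unfolding classical_at_def D_SS_def
    by (auto simp: DERIV_deriv_iff_real_differentiable)
  moreover obtain d where "(u S has_real_derivative d) (at \<tau> within {0..T})"
    using assms(1) unfolding classical_at_def real_differentiable_def by auto
  ultimately show ?thesis
    using D_tau_eq[of u S d \<tau> T] assms(2,3) unfolding has_jet_def
    by (intro conjI exI[of _ "\<lambda>s. D_S u s \<tau>"]) auto
qed

lemma has_jet_add:
  assumes "has_jet T u S \<tau> p q w" "has_jet T u' S \<tau> p' q' w'"
  shows "has_jet T (\<lambda>S \<tau>. u S \<tau> + u' S \<tau>) S \<tau> (p + p') (q + q') (w + w')"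
proof -
  obtain g where g: "\<forall>\<^sub>F s in nhds S. ((\<lambda>s'. u s' \<tau>) has_real_derivative g s) (at s)"
      "g S = p" "(g has_real_derivative q) (at S)"
    and t: "(u S has_real_derivative w) (at \<tau> within {0..T})"
    using assms(1) unfolding has_jet_def by blast
  obtain g' where g': "\<forall>\<^sub>F s in nhds S. ((\<lambda>s'. u' s' \<tau>) has_real_derivative g' s) (at s)"
      "g' S = p'" "(g' has_real_derivative q') (at S)"
    and t': "(u' S has_real_derivative w') (at \<tau> within {0..T})"
    using assms(2) unfolding has_jet_def by blast
  have "\<forall>\<^sub>F s in nhds S. ((\<lambda>s'. u s' \<tau> + u' s' \<tau>) has_real_derivative g s + g' s) (at s)"
    using g(1) g'(1) by eventually_elim (rule DERIV_add)
  then show ?thesis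
    unfolding has_jet_def using g g' DERIV_add[OF t t'] DERIV_add[OF g(3) g'(3)]
    by (intro conjI exI[of _ "\<lambda>s. g s + g' s"]) auto
qed

text \<open>The factor \<open>c\<close> does not depend on \<open>S\<close>, so it passes through
  both spatial derivatives; the product rule shows only in the time entry. It serves for \<chi>, its
  reciprocal and the constant \<open>- 1\<close>.\<close>

lemma has_jet_time_mult:
  assumes "has_jet T u S \<tau> p q w" "(c has_real_derivative c') (at \<tau> within {0..T})"
  shows "has_jet T (\<lambda>S \<tau>. c \<tau> * u S \<tau>) S \<tau> (c \<tau> * p) (c \<tau> * q) (c' * u S \<tau> + c \<tau> * w)"
proof -
  obtain g where g: "\<forall>\<^sub>F s in nhds S. ((\<lambda>s'. u s' \<tau>) has_real_derivative g s) (at s)"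
      "g S = p" "(g has_real_derivative q) (at S)"
    and t: "(u S has_real_derivative w) (at \<tau> within {0..T})"
    using assms(1) unfolding has_jet_def by blast
  have "\<forall>\<^sub>F s in nhds S. ((\<lambda>s'. c \<tau> * u s' \<tau>) has_real_derivative c \<tau> * g s) (at s)"
    using g(1) by eventually_elim (rule DERIV_cmult)
  moreover have "((\<lambda>s. c \<tau> * u S s) has_real_derivative c \<tau> * w) (at \<tau> within {0..T})"
    using t by (rule DERIV_cmult)
  moreover have "((\<lambda>\<sigma>. c \<sigma> * u S \<sigma>) has_real_derivative c' * u S \<tau> + c \<tau> * w)
      (at \<tau> within {0..T})"
    using DERIV_mult[OF assms(2) t] by (simp add: algebra_simps)
  ultimately show ?thesis
    unfolding has_jet_def using g DERIV_cmult[OF g(3), of "c \<tau>"]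
    by (intro conjI exI[of _ "\<lambda>s. c \<tau> * g s"]) auto
qed

lemma has_jet_diff:
  assumes "has_jet T u S \<tau> p q w" "has_jet T u' S \<tau> p' q' w'"
  shows "has_jet T (\<lambda>S \<tau>. u S \<tau> - u' S \<tau>) S \<tau> (p - p') (q - q') (w - w')"
  using has_jet_add[OF assms(1) has_jet_time_mult[OF assms(2), of "\<lambda>_. - 1" 0]] by simp

section \<open>The normal distribution function and its density\<close>

text \<open>Near \<open>x\<close> the distribution function is a constant plus an integral of the
  continuous density, so the fundamental theorem of calculus applies.\<close>

lemma std_normal_cdf_has_derivative:
  "(std_normal_cdf has_real_derivative std_normal_density x) (at x)"
proof -
  have cont: "continuous_on A std_normal_density" for A
    unfolding normal_density_def by (intro continuous_intros) auto
  have int: "set_integrable lborel A std_normal_density" if "A \<in> sets borel" for A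
    unfolding set_integrable_def
    using integrable_mult_indicator[OF _ integrable_normal_density[of 1 0]] that by simp
  interpret D: real_distribution std_normal_distribution
    by (rule real_dist_normal_dist)
  \<comment> \<open>The base point \<open>x - 1\<close> keeps the integral on a compact interval
    with \<open>x\<close> in its interior.\<close>
  have split: "std_normal_cdf y
      = std_normal_cdf (x - 1) + integral {x - 1..y} std_normal_density"
    if y: "y \<in> {x - 1<..<x + 1}" for y
  proof -
    have "std_normal_cdf y - std_normal_cdf (x - 1) = measure std_normal_distribution {x - 1<..y}"
      unfolding std_normal_cdf_def using y by (intro D.cdf_diff_eq) simp
    also have "\<dots> = (LINT u|std_normal_distribution. indicator {x - 1<..y} u)"
      by simp
    also have "\<dots> = (LINT u:{x - 1<..y}|lborel. std_normal_density u)"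
      unfolding set_lebesgue_integral_def
      by (subst integral_density) (auto simp: mult.commute)
    also have "\<dots> = integral {x - 1<..y} std_normal_density"
      by (rule set_borel_integral_eq_integral) (rule int, simp)
    \<comment> \<open>Differences of a distribution function give half-open intervals; the added
      endpoint is a null set.\<close>
    also have "\<dots> = integral {x - 1..y} std_normal_density"
      by (rule integral_subset_negligible) (auto intro: negligible_subset[of "{x - 1}"])
    finally show ?thesis by simp
  qed
  have "((\<lambda>y. integral {x - 1..y} std_normal_density) has_real_derivative std_normal_density x)
      (at x within {x - 1..x + 1})"
    by (rule integral_has_real_derivative) (auto intro: cont)
  then have "((\<lambda>y. integral {x - 1..y} std_normal_density) has_real_derivative
      std_normal_density x) (at x)"
    by (simp add: at_within_Icc_at)
  then have "((\<lambda>y. std_normal_cdf (x - 1) + integral {x - 1..y} std_normal_density)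
      has_real_derivative std_normal_density x) (at x)"
    by (auto intro!: derivative_eq_intros)
  then show ?thesis
    by (rule has_field_derivative_transform_within_open[of _ _ _ "{x - 1<..<x + 1}"])
      (simp_all add: split)
qed

lemmas std_normal_cdf_chain = DERIV_chain2[OF std_normal_cdf_has_derivative]

text \<open>The squares of \<open>d_plus\<close> and \<open>d_minus\<close> differ by
  \<open>2 * (ln (S / K) + r * \<tau>)\<close>, so the ratio of the two densities is
  \<open>K * exp (- r * \<tau>) / S\<close>.\<close>

lemma std_normal_density_d_plus_d_minus:
  assumes "A0 a K T \<tau> > 0" "K > 0" "S > 0"
  shows "S * std_normal_density (d_plus a r K T S \<tau>)
    = K * exp (- r * \<tau>) * std_normal_density (d_minus a r K T S \<tau>)"
proof -
  define A where "A = A0 a K T \<tau>"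
  define L where "L = ln (S / K)"
  have A: "A > 0" using assms A_def by simp
  have S: "S = K * exp L" using assms by (simp add: L_def)
  have sq: "(x / sqrt A)\<^sup>2 = x\<^sup>2 / A" for x
    using A by (simp add: power_divide)
  have "L + - ((L + r * \<tau> + A / 2)\<^sup>2 / A) / 2 = - r * \<tau> + - ((L + r * \<tau> - A / 2)\<^sup>2 / A) / 2"
    using A by (simp add: field_simps power2_eq_square)
  then have "exp L * exp (- ((L + r * \<tau> + A / 2)\<^sup>2 / A) / 2)
      = exp (- r * \<tau>) * exp (- ((L + r * \<tau> - A / 2)\<^sup>2 / A) / 2)"
    unfolding exp_add[symmetric] by simp
  then show ?thesis
    unfolding d_plus_def d_minus_def A_def[symmetric] L_def[symmetric] std_normal_density_def sq
    by (simp add: S)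
qed

section \<open>Greeks of the carrier\<close>

text \<open>The density identity cancels the terms from differentiating \<open>d_plus\<close> and
  \<open>d_minus\<close> in \<open>S\<close>. In \<tau> it leaves only the derivative of
  \<open>d_plus - d_minus\<close>, which equals \<open>sqrt A0\<close>. The entries are delta, gamma
  and, as \<tau> is remaining time, minus theta.\<close>

lemma C_ref_has_jet:
  assumes "K > 0" "S > 0" "A0 a K T \<tau> > 0"
    and A': "(A0 a K T has_real_derivative A') (at \<tau> within {0..T})"
  shows "has_jet T (C_ref a r K T) S \<tau>
    (std_normal_cdf (d_plus a r K T S \<tau>))
    (std_normal_density (d_plus a r K T S \<tau>) / (S * sqrt (A0 a K T \<tau>)))
    (S * std_normal_density (d_plus a r K T S \<tau>) * A' / (2 * sqrt (A0 a K T \<tau>))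
      + r * K * exp (- r * \<tau>) * std_normal_cdf (d_minus a r K T S \<tau>))"
proof -
  let ?A = "A0 a K T" and ?\<phi> = std_normal_density and ?\<Phi> = std_normal_cdf
  let ?p = "d_plus a r K T" and ?m = "d_minus a r K T"
  have pS: "((\<lambda>s. ?p s \<tau>) has_real_derivative 1 / (s * sqrt (?A \<tau>))) (at s)"
    and mS: "((\<lambda>s. ?m s \<tau>) has_real_derivative 1 / (s * sqrt (?A \<tau>))) (at s)"
    if "s > 0" for s
    using that assms(1,3) unfolding d_plus_def d_minus_def
    by (auto intro!: derivative_eq_intros simp: field_simps)
  have delta: "((\<lambda>s. C_ref a r K T s \<tau>) has_real_derivative ?\<Phi> (?p s \<tau>)) (at s)"
    if s: "s > 0" for s
  proof -
    have "((\<lambda>s. C_ref a r K T s \<tau>) has_real_derivative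
        (1 * ?\<Phi> (?p s \<tau>) + ?\<phi> (?p s \<tau>) * (1 / (s * sqrt (?A \<tau>))) * s)
        - K * exp (- r * \<tau>) * (?\<phi> (?m s \<tau>) * (1 / (s * sqrt (?A \<tau>))))) (at s)"
      unfolding C_ref_def
      by (intro DERIV_diff DERIV_mult DERIV_cmult DERIV_ident std_normal_cdf_chain pS mS s)
    \<comment> \<open>Both arguments have the same \<open>S\<close>-derivative, so this is the
      density identity times a common factor.\<close>
    moreover have "?\<phi> (?p s \<tau>) * (1 / (s * sqrt (?A \<tau>))) * s
        = K * exp (- r * \<tau>) * (?\<phi> (?m s \<tau>) * (1 / (s * sqrt (?A \<tau>))))"
      using std_normal_density_d_plus_d_minus[OF assms(3,1) s, of r]
      by (simp add: mult.commute)
    ultimately show ?thesis by simp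
  qed
  have "\<forall>\<^sub>F s in nhds S. s \<in> {0<..}"
    using assms(2) by (intro eventually_nhds_in_open) auto
  then have ev: "\<forall>\<^sub>F s in nhds S.
      ((\<lambda>s'. C_ref a r K T s' \<tau>) has_real_derivative ?\<Phi> (?p s \<tau>)) (at s)"
    by eventually_elim (simp add: delta)
  have gamma: "((\<lambda>s. ?\<Phi> (?p s \<tau>)) has_real_derivative ?\<phi> (?p S \<tau>) / (S * sqrt (?A \<tau>))) (at S)"
    using std_normal_cdf_chain[OF pS[OF assms(2)]] by simp
  have sqrtA: "((\<lambda>\<sigma>. sqrt (?A \<sigma>)) has_real_derivative A' / (2 * sqrt (?A \<tau>)))
      (at \<tau> within {0..T})"
    using assms(3) A' by (auto intro!: derivative_eq_intros simp: field_simps)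
  \<comment> \<open>\<open>p'\<close> and \<open>m'\<close> are the raw output of the quotient rule;
    only their difference will matter.\<close>
  define p' where "p' = ((r + A' / 2) * sqrt (?A \<tau>)
      - (ln (S / K) + r * \<tau> + ?A \<tau> / 2) * (A' / (2 * sqrt (?A \<tau>)))) / (sqrt (?A \<tau>) * sqrt (?A \<tau>))"
  define m' where "m' = ((r - A' / 2) * sqrt (?A \<tau>)
      - (ln (S / K) + r * \<tau> - ?A \<tau> / 2) * (A' / (2 * sqrt (?A \<tau>)))) / (sqrt (?A \<tau>) * sqrt (?A \<tau>))"
  have nz: "sqrt (?A \<tau>) \<noteq> 0"
    using assms(3) by simp
  have p': "(?p S has_real_derivative p') (at \<tau> within {0..T})"
    unfolding d_plus_def p'_def
    by (rule DERIV_divide[OF _ sqrtA nz]) (auto intro!: derivative_eq_intros A')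
  have m': "(?m S has_real_derivative m') (at \<tau> within {0..T})"
    unfolding d_minus_def m'_def
    by (rule DERIV_divide[OF _ sqrtA nz]) (auto intro!: derivative_eq_intros A')
  have p'm': "p' - m' = A' / (2 * sqrt (?A \<tau>))"
  proof -
    define s where "s = sqrt (?A \<tau>)"
    have s: "s > 0" "?A \<tau> = s * s" using assms(3) by (simp_all add: s_def)
    show ?thesis
      unfolding p'_def m'_def s_def[symmetric] s(2) using s(1) by (simp add: field_simps)
  qed
  have "(C_ref a r K T S has_real_derivative
      S * (?\<phi> (?p S \<tau>) * p') - (- r * (K * exp (- r * \<tau>)) * ?\<Phi> (?m S \<tau>)
        + ?\<phi> (?m S \<tau>) * m' * (K * exp (- r * \<tau>)))) (at \<tau> within {0..T})"
    unfolding C_ref_def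
    by (intro DERIV_diff DERIV_mult DERIV_cmult std_normal_cdf_chain p' m')
      (auto intro!: derivative_eq_intros)
  moreover have "S * (?\<phi> (?p S \<tau>) * p') - ?\<phi> (?m S \<tau>) * m' * (K * exp (- r * \<tau>))
      = S * ?\<phi> (?p S \<tau>) * (p' - m')"
    using std_normal_density_d_plus_d_minus[OF assms(3,1,2), of r]
    by (simp add: algebra_simps)
  ultimately have theta: "(C_ref a r K T S has_real_derivative
      S * ?\<phi> (?p S \<tau>) * A' / (2 * sqrt (?A \<tau>)) + r * K * exp (- r * \<tau>) * ?\<Phi> (?m S \<tau>))
      (at \<tau> within {0..T})"
    unfolding p'm' by (simp add: algebra_simps)
  show ?thesis
    unfolding has_jet_def using ev gamma theta
    by (intro conjI exI[of _ "\<lambda>s. ?\<Phi> (?p s \<tau>)"]) auto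
qed

section \<open>The pricing operator on carrier, approximation and error\<close>

lemma P_op_has_jet:
  assumes "has_jet T u S \<tau> p q w" "\<tau> \<in> {0..T}" "T > 0"
  shows "P_op a r T u S \<tau> = w - 1 / 2 * a S (T - \<tau>) * S\<^sup>2 * q - r * S * p + r * u S \<tau>"
  unfolding P_op_def using has_jet_D[OF assms] by simp

text \<open>The carrier solves the equation whose variance is frozen at the strike,
  \<open>a K\<close> in place of \<open>a S\<close>. Only the second-order coefficients differ, and
  that mismatch is the source.\<close>

lemma P_op_C_ref:
  assumes "K > 0" "S > 0" "A0 a K T \<tau> > 0" "\<tau> \<in> {0..T}" "T > 0"
    and "(A0 a K T has_real_derivative a K (T - \<tau>)) (at \<tau> within {0..T})"
  shows "P_op a r T (C_ref a r K T) S \<tau> = - source a r K T S \<tau>"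
proof -
  note jet = C_ref_has_jet[OF assms(1-3,6), of r]
  define s where "s = sqrt (A0 a K T \<tau>)"
  have "s > 0" using assms(3) by (simp add: s_def)
  then show ?thesis
    unfolding P_op_has_jet[OF jet assms(4,5)] source_def has_jet_D(2)[OF jet assms(4,5)]
      s_def[symmetric]
    using assms(2) by (simp add: C_ref_def field_simps power2_eq_square)
qed

lemma z_theta_has_jet:
  assumes "has_jet T (C_ref a r K T) S \<tau> p q w" "has_jet T (in_tau T R) S \<tau> p' q' w'" "T > 0"
  shows "has_jet T (z_theta a r K T R) S \<tau> (p + \<tau> / T * p') (q + \<tau> / T * q')
    (w + (in_tau T R S \<tau> / T + \<tau> / T * w'))"
proof -
  have "((\<lambda>\<sigma>. \<sigma> / T) has_real_derivative 1 / T) (at \<tau> within {0..T})"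
    using assms(3) by (auto intro!: derivative_eq_intros)
  from has_jet_add[OF assms(1) has_jet_time_mult[OF assms(2) this]] show ?thesis
    by (simp add: z_theta_def[abs_def])
qed

text \<open>\<open>R_star\<close> is the time factor \<open>T / \<tau>\<close> times
  \<open>V - C_ref\<close>; \<tau> > 0 keeps that factor differentiable.\<close>

lemma rho_theta_has_jet:
  assumes "has_jet T (C_ref a r K T) S \<tau> p q w" "has_jet T (in_tau T R) S \<tau> p' q' w'"
    and "has_jet T (in_tau T V) S \<tau> p'' q'' w''" "\<tau> > 0" "T > 0"
  shows "has_jet T (rho_theta a r K T V R) S \<tau>
    (p' - T / \<tau> * (p'' - p)) (q' - T / \<tau> * (q'' - q))
    (w' - (- T / \<tau>\<^sup>2 * (in_tau T V S \<tau> - C_ref a r K T S \<tau>) + T / \<tau> * (w'' - w)))"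
proof -
  have "((\<lambda>\<sigma>. T / \<sigma>) has_real_derivative - T / \<tau>\<^sup>2) (at \<tau> within {0..T})"
    using assms(4) by (auto intro!: derivative_eq_intros simp: power2_eq_square)
  from has_jet_diff[OF assms(2) has_jet_time_mult[OF has_jet_diff[OF assms(3,1)] this]]
  show ?thesis
    by (simp add: rho_theta_def[abs_def] R_star_def[abs_def] mult.commute)
qed

section \<open>The scaled norm and the assembled estimates\<close>

text \<open>Each of three nonnegative summands is at most their sum. Boundedness makes the real
  supremum an upper bound.\<close>

lemma scaled_size_le_scaled_norm:
  assumes "bdd_above (scaled_size K T u ` \<Omega>)" "(S, t) \<in> \<Omega>" "K > 0" "T > 0" "T - t > 0"
  defines "\<eta> \<equiv> (T - t) / T"
  shows "\<bar>u S (T - t)\<bar> / K \<le> scaled_norm K T \<Omega> u"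
    and "sqrt \<eta> * \<bar>D_S u S (T - t)\<bar> \<le> scaled_norm K T \<Omega> u"
    and "\<eta> * K * \<bar>D_SS u S (T - t)\<bar> \<le> scaled_norm K T \<Omega> u"
proof -
  have "scaled_size K T u (S, t) \<le> scaled_norm K T \<Omega> u"
    unfolding scaled_norm_def by (rule cSUP_upper[OF assms(2,1)])
  then have sum: "\<bar>u S (T - t)\<bar> / K + sqrt \<eta> * \<bar>D_S u S (T - t)\<bar>
      + \<eta> * K * \<bar>D_SS u S (T - t)\<bar> \<le> scaled_norm K T \<Omega> u"
    by (simp add: scaled_size_def Let_def \<eta>_def)
  have "\<eta> > 0" using assms by simp
  then have "\<bar>u S (T - t)\<bar> / K \<ge> 0" "sqrt \<eta> * \<bar>D_S u S (T - t)\<bar> \<ge> 0"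
      "\<eta> * K * \<bar>D_SS u S (T - t)\<bar> \<ge> 0"
    using assms(3) by simp_all
  with sum show "\<bar>u S (T - t)\<bar> / K \<le> scaled_norm K T \<Omega> u"
    and "sqrt \<eta> * \<bar>D_S u S (T - t)\<bar> \<le> scaled_norm K T \<Omega> u"
    and "\<eta> * K * \<bar>D_SS u S (T - t)\<bar> \<le> scaled_norm K T \<Omega> u"
    by linarith+
qed

theorem mainTheorem3:
  fixes a V R\<^sub>\<theta> :: "real \<Rightarrow> real \<Rightarrow> real"
    and r K T :: real
    and \<Omega> :: "(real \<times> real) set"
  assumes "K > 0" and "T > 0"
    and "\<forall>S>0. \<forall>t\<in>{0..T}. a S t > 0"
    and "(\<lambda>u. a K (T - u)) integrable_on {0..T}"
    and "\<forall>\<tau>\<in>{0<..T}. A0 a K T \<tau> > 0"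
    and "call_price a r K T V"
    and "\<forall>(S, t)\<in>\<Omega>. S > 0 \<and> T - t \<in> {0<..T}"
    and "\<forall>(S, t)\<in>\<Omega>.
           (A0 a K T has_real_derivative a K t) (at (T - t) within {0..T})"
    and "\<forall>(S, t)\<in>\<Omega>. classical_at T (in_tau T V) S (T - t)
                      \<and> classical_at T (in_tau T R\<^sub>\<theta>) S (T - t)"
  shows
    "let v = in_tau T V; R = in_tau T R\<^sub>\<theta>; f = source a r K T;
         z = z_theta a r K T R\<^sub>\<theta>; \<rho> = rho_theta a r K T V R\<^sub>\<theta>;
         N = scaled_norm K T \<Omega> \<rho>; P = P_op a r T
     in (\<forall>(S, t)\<in>\<Omega>. let \<tau> = T - t in
           z S \<tau> - v S \<tau> = \<tau> / T * \<rho> S \<tau>) \<and>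
        (bdd_above (scaled_size K T \<rho> ` \<Omega>) \<longrightarrow>
          (\<forall>(S, t)\<in>\<Omega>. let \<tau> = T - t in
             \<bar>z S \<tau> - v S \<tau>\<bar> / K \<le> \<tau> / T * N \<and>
             \<bar>D_S z S \<tau> - D_S v S \<tau>\<bar> \<le> sqrt (\<tau> / T) * N \<and>
             K * \<bar>D_SS z S \<tau> - D_SS v S \<tau>\<bar> \<le> N)) \<and>
        (\<forall>(S, t)\<in>\<Omega>. let \<tau> = T - t in
           P z S \<tau> = - f S \<tau> + \<tau> / T * P R S \<tau> + R S \<tau> / T \<and>
           P z S \<tau> = \<tau> / T * P \<rho> S \<tau> + \<rho> S \<tau> / T)"
proof -
  let ?v = "in_tau T V" and ?R = "in_tau T R\<^sub>\<theta>" and ?f = "source a r K T"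
    and ?C = "C_ref a r K T" and ?z = "z_theta a r K T R\<^sub>\<theta>"
    and ?\<rho> = "rho_theta a r K T V R\<^sub>\<theta>" and ?P = "P_op a r T"
  let ?N = "scaled_norm K T \<Omega> ?\<rho>"
  have main: "?z S \<tau> - ?v S \<tau> = \<tau> / T * ?\<rho> S \<tau>
      \<and> D_S ?z S \<tau> - D_S ?v S \<tau> = \<tau> / T * D_S ?\<rho> S \<tau>
      \<and> D_SS ?z S \<tau> - D_SS ?v S \<tau> = \<tau> / T * D_SS ?\<rho> S \<tau>
      \<and> ?P ?z S \<tau> = - ?f S \<tau> + \<tau> / T * ?P ?R S \<tau> + ?R S \<tau> / T
      \<and> ?P ?z S \<tau> = \<tau> / T * ?P ?\<rho> S \<tau> + ?\<rho> S \<tau> / T"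
    if "(S, t) \<in> \<Omega>" and \<tau>: "\<tau> = T - t" for S t \<tau>
  proof -
    have S: "S > 0" and \<tau>0: "\<tau> > 0" and \<tau>T: "\<tau> \<in> {0..T}" and \<tau>0T: "\<tau> \<in> {0<..T}"
      using assms(7) that by auto
    have A: "A0 a K T \<tau> > 0" using assms(5) \<tau>0T by blast
    have A': "(A0 a K T has_real_derivative a K (T - \<tau>)) (at \<tau> within {0..T})"
      using assms(8) that by auto
    have cV: "classical_at T ?v S \<tau>" and cR: "classical_at T ?R S \<tau>"
      using assms(9) that by auto
    note jV = classical_at_has_jet[OF cV \<tau>T assms(2)]
    note jR = classical_at_has_jet[OF cR \<tau>T assms(2)]
    note jC' = C_ref_has_jet[OF assms(1) S A A', of r]
    \<comment> \<open>The explicit Greeks are traded for abstract derivatives, so the remaining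
      algebra is purely linear.\<close>
    have jC: "has_jet T ?C S \<tau> (D_S ?C S \<tau>) (D_SS ?C S \<tau>) (D_tau T ?C S \<tau>)"
      using jC' has_jet_D[OF jC' \<tau>T assms(2)] by simp
    note jz = z_theta_has_jet[OF jC jR assms(2)]
    note j\<rho> = rho_theta_has_jet[OF jC jR jV \<tau>0 assms(2)]
    \<comment> \<open>\<open>call_price\<close> imposes the equation only at classical points, hence
      the use of \<open>cV\<close>.\<close>
    have PV: "?P ?v S \<tau> = 0"
      using assms(6) S \<tau>0T cV unfolding call_price_def by blast
    have PC: "?P ?C S \<tau> = - ?f S \<tau>"
      by (rule P_op_C_ref[OF assms(1) S A \<tau>T assms(2) A'])
    have \<rho>: "?\<rho> S \<tau> = ?R S \<tau> - T / \<tau> * (?v S \<tau> - ?C S \<tau>)"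
      using \<tau>0 by (simp add: rho_theta_def R_star_def)
    have z: "?z S \<tau> = ?C S \<tau> + \<tau> / T * ?R S \<tau>"
      by (simp add: z_theta_def)
    have Pz: "?P ?z S \<tau> = - ?f S \<tau> + \<tau> / T * ?P ?R S \<tau> + ?R S \<tau> / T"
      unfolding P_op_has_jet[OF jz \<tau>T assms(2)] z PC[symmetric] P_op_def[of a r T ?C]
        P_op_def[of a r T ?R]
      by (simp add: algebra_simps)
    \<comment> \<open>The left side is the operator applied to \<chi>\<rho> = \<open>C_ref\<close> +
      \<chi>\<open>R\<close> - \<open>V\<close>. The term from differentiating
      \<open>T / \<tau>\<close> cancels the part of \<open>?\<rho> S \<tau> / T\<close> that
      contains \<open>V - C_ref\<close>.\<close>
    have "\<tau> / T * ?P ?\<rho> S \<tau> + ?\<rho> S \<tau> / T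
        = ?P ?C S \<tau> - ?P ?v S \<tau> + \<tau> / T * ?P ?R S \<tau> + ?R S \<tau> / T"
      unfolding P_op_has_jet[OF j\<rho> \<tau>T assms(2)] \<rho> P_op_def[of a r T ?C] P_op_def[of a r T ?R]
        P_op_def[of a r T ?v]
      using \<tau>0 assms(2) by (simp add: field_simps power2_eq_square)
    then have P\<rho>: "?P ?z S \<tau> = \<tau> / T * ?P ?\<rho> S \<tau> + ?\<rho> S \<tau> / T"
      unfolding Pz PC PV by simp
    have "?z S \<tau> - ?v S \<tau> = \<tau> / T * ?\<rho> S \<tau>"
      "D_S ?z S \<tau> - D_S ?v S \<tau> = \<tau> / T * D_S ?\<rho> S \<tau>"
      "D_SS ?z S \<tau> - D_SS ?v S \<tau> = \<tau> / T * D_SS ?\<rho> S \<tau>"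
      unfolding has_jet_D[OF jz \<tau>T assms(2)] has_jet_D[OF j\<rho> \<tau>T assms(2)] \<rho> z
      using \<tau>0 assms(2) by (simp_all add: field_simps)
    with Pz P\<rho> show ?thesis by blast
  qed
  have bounds: "\<bar>?z S \<tau> - ?v S \<tau>\<bar> / K \<le> \<tau> / T * ?N
      \<and> \<bar>D_S ?z S \<tau> - D_S ?v S \<tau>\<bar> \<le> sqrt (\<tau> / T) * ?N
      \<and> K * \<bar>D_SS ?z S \<tau> - D_SS ?v S \<tau>\<bar> \<le> ?N"
    if bdd: "bdd_above (scaled_size K T ?\<rho> ` \<Omega>)" and mem: "(S, t) \<in> \<Omega>" and \<tau>: "\<tau> = T - t"
    for S t \<tau>
  proof -
    define \<eta> where "\<eta> = \<tau> / T"
    have "T - t > 0" using assms(7) mem by auto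
    note le = scaled_size_le_scaled_norm[OF bdd mem assms(1,2) this, folded \<tau>, folded \<eta>_def]
    have \<eta>: "\<eta> > 0" using \<open>T - t > 0\<close> assms(2) \<tau> by (simp add: \<eta>_def)
    have eqs: "?z S \<tau> - ?v S \<tau> = \<eta> * ?\<rho> S \<tau>" "D_S ?z S \<tau> - D_S ?v S \<tau> = \<eta> * D_S ?\<rho> S \<tau>"
        "D_SS ?z S \<tau> - D_SS ?v S \<tau> = \<eta> * D_SS ?\<rho> S \<tau>"
      using main[OF mem \<tau>] by (simp_all add: \<eta>_def)
    have "\<bar>\<eta> * ?\<rho> S \<tau>\<bar> / K \<le> \<eta> * ?N"
      using mult_left_mono[OF le(1), of \<eta>] \<eta> by (simp add: abs_mult)
    \<comment> \<open>One root of \<eta> is the weight inside the norm, the other stays in the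
      bound.\<close>
    moreover have "\<bar>\<eta> * D_S ?\<rho> S \<tau>\<bar> = sqrt \<eta> * (sqrt \<eta> * \<bar>D_S ?\<rho> S \<tau>\<bar>)"
      using \<eta> by (simp add: abs_mult mult.assoc[symmetric])
    then have "\<bar>\<eta> * D_S ?\<rho> S \<tau>\<bar> \<le> sqrt \<eta> * ?N"
      using mult_left_mono[OF le(2), of "sqrt \<eta>"] \<eta> by simp
    \<comment> \<open>Here the weight in the norm absorbs all of \<eta>, so no power of it
      remains.\<close>
    moreover have "K * \<bar>\<eta> * D_SS ?\<rho> S \<tau>\<bar> \<le> ?N"
      using le(3) \<eta> by (simp add: abs_mult mult_ac)
    ultimately show ?thesis
      unfolding eqs \<eta>_def[symmetric] by blast
  qed
  show ?thesis
    unfolding Let_def using main bounds by blast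
qed

end
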